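(* Let $D$ be a finite set, $M=\mathrm{QoI}(D)$, $\sigma:\mathit{Var}\to M_1$, let $u,w,v_0\in\mathit{Var}$ be distinct and $C_3=(u:=v_0;\;w:=v_0)$. Any sound independent-attribute mechanism, by any rules whatsoever, certifies for $C_3$ and $W=\{u,w\}$ a bound $\sqsupseteq\sigma(v_0)\otimes\sigma(v_0)$. That is: if $\Gamma':\mathit{Var}\to M$ satisfies $\pi_{W'}\circ\llbracket C_3\rrbracket\circ\hat g:\bigotimes_{x\in W'}\Gamma'(x)\Rightarrow\mathrm{Id}$ for every mediator family $g$ legal for $\sigma$ and every $W'\subseteq\mathit{Var}$, then $\Gamma'(u)\otimes\Gamma'(w)\sqsupseteq\sigma(v_0)\otimes\sigma(v_0)$.
   Context: Independent-attribute mechanisms: environments assign one element of $M$ to each variable, and the observation of $W$ is read out as $\bigotimes_{w\in W}\Gamma'(w)$; soundness is the condition displayed in the claim. Quantale of information. $D$ is finite. $\mathrm{LoI}(D)$ is the set of equivalence relations on $D$ ordered by $P\sqsubseteq Q$ iff $Q\subseteq P$, so $P\sqcup Q=P\cap Q$, the least element $\mathrm{All}$ is the total relation and the greatest, $\mathrm{Id}$, is equality. For $\mathbb P\subseteq\mathrm{LoI}(D)$, $\mathrm{mix}(\mathbb P)$ is the set of equivalence relations each of whose cells is a cell of some member of $\mathbb P$, and $\mathrm{tc}(\mathbb P)={\downarrow}\mathrm{mix}(\mathbb P)$. $\mathrm{QoI}(D)$ is the set of $\mathbb P$ with $\mathrm{tc}(\mathbb P)=\mathbb P$, ordered by inclusion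 (written $\sqsubseteq$), with $\bigvee_i\mathbb P_i=\mathrm{tc}(\bigcup_i\mathbb P_i)$, $\mathbb P\otimes\mathbb Q=\mathrm{tc}\{P\sqcup Q\mid P\in\mathbb P,Q\in\mathbb Q\}$, unit $1=\{\mathrm{All}\}$; it is a commutative complete quantale. $M_1=\{m\mid 1\sqsubseteq m\}$ (the nonempty elements). Empty tensors are $1$. $\mathit{Var}$ is finite; stores are maps $\mathit{Var}\to\mathit{Val}$; $\mathit{Val}$ contains an encoding (injective image) of every quotient $D/P$, $P\in\mathrm{LoI}(D)$. $\llbracket C_3\rrbracket$ is the evident store transformer of the two assignments. $\pi_W$ restricts a store to $W$. Mediators. For a partial function $h$ on $D$ and $\mathbb P\in\mathrm{QoI}(D)$, $h:\mathbb P\Rightarrow\mathrm{Id}$ means: some $P\in\mathbb P$ satisfies $h(d)=h(d')$ whenever $d\,P\,d'$ and both are defined. A mediator family is $g=\langle g_v:D\rightharpoonup\mathit{Val}\rangle_{v\in\mathit{Var}}$ of partial functions with a common domain; $\hat g(d)$ is the store with $v$-component $g_v(d)$. $g$ is legal for $\sigma$ when $g_v:\sigma(v)\Rightarrow\mathrm{Id}$ for every $v$. *)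

theory Defs
  imports "HOL-Algebra.FiniteProduct"
begin

section \<open>The quantale of information\<close>

text \<open>
  An element of \<open>LoI D\<close> is an equivalence relation on \<open>D\<close>, given as a set of pairs.  The order on
  \<open>LoI D\<close> is reverse inclusion, so the join of two relations is their intersection, the least
  element is \<open>D \<times> D\<close> and the greatest is \<open>Id_on D\<close>.
\<close>

definition LoI :: "'d set \<Rightarrow> 'd rel set"
  where "LoI D = {P. equiv D P}"

definition loi_le :: "'d rel \<Rightarrow> 'd rel \<Rightarrow> bool"
  where "loi_le P Q \<longleftrightarrow> Q \<subseteq> P"

definition loi_join :: "'d rel \<Rightarrow> 'd rel \<Rightarrow> 'd rel"
  where "loi_join P Q = P \<inter> Q"

definition mix :: "'d set \<Rightarrow> 'd rel set \<Rightarrow> 'd rel set"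
  where "mix D \<PP> = {Q \<in> LoI D. \<forall>C \<in> D // Q. \<exists>P \<in> \<PP>. C \<in> D // P}"

definition tc :: "'d set \<Rightarrow> 'd rel set \<Rightarrow> 'd rel set"
  where "tc D \<PP> = {P \<in> LoI D. \<exists>Q \<in> mix D \<PP>. loi_le P Q}"

definition QoI :: "'d set \<Rightarrow> 'd rel set set"
  where "QoI D = {\<PP>. \<PP> \<subseteq> LoI D \<and> tc D \<PP> = \<PP>}"

text \<open>
  The order on \<open>QoI D\<close> is set inclusion.  Packaging its tensor as a commutative monoid in the
  sense of \<^theory>\<open>HOL-Algebra.Group\<close> makes \<^const>\<open>finprod\<close> the finite tensor, with the empty
  tensor equal to the unit.
\<close>

definition QoI_monoid :: "'d set \<Rightarrow> 'd rel set monoid"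
  where "QoI_monoid D =
    \<lparr>carrier = QoI D,
     mult = (\<lambda>\<PP> \<QQ>. tc D {loi_join P Q | P Q. P \<in> \<PP> \<and> Q \<in> \<QQ>}),
     one = {D \<times> D}\<rparr>"

definition QoI1 :: "'d set \<Rightarrow> 'd rel set set"
  where "QoI1 D = {m \<in> QoI D. \<one>\<^bsub>QoI_monoid D\<^esub> \<subseteq> m}"

lemma loi_join_LoI: "P \<in> LoI D \<Longrightarrow> Q \<in> LoI D \<Longrightarrow> loi_join P Q \<in> LoI D"
  unfolding LoI_def loi_join_def equiv_def refl_on_def sym_def trans_def by blast

lemma mix_iff:
  assumes "A \<subseteq> LoI D"
  shows "Q \<in> mix D A \<longleftrightarrow> Q \<in> LoI D \<and> (\<forall>d \<in> D. \<exists>P \<in> A. Q `` {d} = P `` {d})"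
proof -
  have "(Q `` {d} \<in> D // P) = (Q `` {d} = P `` {d})"
    if "Q \<in> LoI D" "P \<in> A" "d \<in> D" for d P
  proof
    have P: "equiv D P" and Q: "equiv D Q" using that assms by (auto simp: LoI_def)
    assume "Q `` {d} \<in> D // P"
    then obtain e where e: "e \<in> D" "Q `` {d} = P `` {e}" by (auto simp: quotient_def)
    have "d \<in> Q `` {d}" using equiv_class_self[OF Q \<open>d \<in> D\<close>] .
    then have "(e, d) \<in> P" using e by auto
    then show "Q `` {d} = P `` {d}" using equiv_class_eq[OF P] e by metis
  next
    assume "Q `` {d} = P `` {d}"
    then show "Q `` {d} \<in> D // P" using that by (auto simp: quotient_def)
  qed
  then show ?thesis by (fastforce simp: mix_def quotient_def)
qed

lemma tc_LoI: "tc D A \<subseteq> LoI D"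
  by (auto simp: tc_def)

lemma tc_mono: "A \<subseteq> B \<Longrightarrow> tc D A \<subseteq> tc D B"
  by (fastforce simp: tc_def mix_def)

lemma tc_extensive:
  assumes "A \<subseteq> LoI D"
  shows "A \<subseteq> tc D A"
proof
  fix P assume "P \<in> A"
  then have "P \<in> mix D A" using assms by (auto simp: mix_def)
  then show "P \<in> tc D A" by (auto simp: tc_def mix_def loi_le_def)
qed

lemma tc_idem:
  assumes A: "A \<subseteq> LoI D"
  shows "tc D (tc D A) = tc D A"
proof
  show "tc D A \<subseteq> tc D (tc D A)" by (rule tc_extensive[OF tc_LoI])
  show "tc D (tc D A) \<subseteq> tc D A"
  proof
    fix P assume "P \<in> tc D (tc D A)"
    then obtain M where P: "P \<in> LoI D" "M \<subseteq> P" and M: "M \<in> mix D (tc D A)"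
      by (auto simp: tc_def loi_le_def)
    have eM: "equiv D M" using M by (auto simp: mix_iff[OF tc_LoI] LoI_def)
    have cell: "\<exists>N. N \<in> mix D A \<and> (\<forall>x \<in> C. N `` {x} \<subseteq> C)" if C: "C \<in> D // M" for C
    proof -
      obtain d where d: "d \<in> D" "C = M `` {d}" using C by (auto simp: quotient_def)
      obtain N where N: "N \<in> tc D A" "M `` {d} = N `` {d}"
        using M d by (auto simp: mix_iff[OF tc_LoI])
      obtain N' where N': "N' \<in> mix D A" "N' \<subseteq> N" using N by (auto simp: tc_def loi_le_def)
      have "trans N" using N by (auto simp: tc_def LoI_def equiv_def)
      then have "\<forall>x \<in> C. N' `` {x} \<subseteq> C" using d N N' by (fastforce dest: transD)
      then show ?thesis using N' by blast
    qed
    then obtain N where N: "\<And>C. C \<in> D // M \<Longrightarrow> N C \<in> mix D A"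
      and Nsub: "\<And>C x. C \<in> D // M \<Longrightarrow> x \<in> C \<Longrightarrow> N C `` {x} \<subseteq> C" by metis
    define R where "R = {(x, y). x \<in> D \<and> (x, y) \<in> N (M `` {x})}"
    have eN: "equiv D (N (M `` {x}))" if "x \<in> D" for x
      using N[OF quotientI[OF that]] by (auto simp: mix_def LoI_def)
    have RM: "R \<subseteq> M"
    proof clarify
      fix x y assume "(x, y) \<in> R"
      then have x: "x \<in> D" "(x, y) \<in> N (M `` {x})" by (auto simp: R_def)
      show "(x, y) \<in> M"
        using Nsub[OF quotientI[OF x(1)] equiv_class_self[OF eM x(1)]] x(2) by auto
    qed
    have same: "M `` {x} = M `` {y}" if "(x, y) \<in> R" for x y
      using that RM equiv_class_eq[OF eM] by blast
    have eR: "equiv D R"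
    proof (rule equivI)
      show "R \<subseteq> D \<times> D" using RM eM by (auto simp: equiv_def)
      show "refl_on D R" using eN by (auto simp: refl_on_def R_def equiv_def)
      show "sym R"
      proof (rule symI)
        fix x y assume R: "(x, y) \<in> R"
        then have "x \<in> D" "(x, y) \<in> N (M `` {x})" by (auto simp: R_def)
        then have "(y, x) \<in> N (M `` {x})" "y \<in> D" using eN[of x] by (auto simp: equiv_def dest: symD)
        then show "(y, x) \<in> R" using same[OF R] by (simp add: R_def)
      qed
      show "trans R"
      proof (rule transI)
        fix x y z assume R: "(x, y) \<in> R" "(y, z) \<in> R"
        then have "x \<in> D" "(x, y) \<in> N (M `` {x})" "(y, z) \<in> N (M `` {x})"
          using same[OF R(1)] by (auto simp: R_def)
        then have "(x, z) \<in> N (M `` {x})" using eN[of x] by (auto simp: equiv_def dest: transD)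
        then show "(x, z) \<in> R" using \<open>x \<in> D\<close> by (simp add: R_def)
      qed
    qed
    have "\<exists>Q \<in> A. R `` {d} = Q `` {d}" if "d \<in> D" for d
    proof -
      have "R `` {d} = N (M `` {d}) `` {d}" using that by (auto simp: R_def)
      then show ?thesis using N[OF quotientI[OF that]] that by (auto simp: mix_iff[OF A])
    qed
    then have "R \<in> mix D A" using eR by (auto simp: mix_iff[OF A] LoI_def)
    then show "P \<in> tc D A" using P RM by (auto simp: tc_def loi_le_def)
  qed
qed

abbreviation (input) joins :: "'d rel set \<Rightarrow> 'd rel set \<Rightarrow> 'd rel set"
  where "joins A B \<equiv> {loi_join P Q | P Q. P \<in> A \<and> Q \<in> B}"

lemma joins_LoI: "A \<subseteq> LoI D \<Longrightarrow> B \<subseteq> LoI D \<Longrightarrow> joins A B \<subseteq> LoI D"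
  using loi_join_LoI by blast

lemma joins_commute: "joins A B = joins B A"
  by (auto simp: loi_join_def)

lemma joins_assoc:
  fixes A B C :: "'d rel set"
  shows "joins (joins A B) C = joins A (joins B C)"
proof -
  have *: "joins X Y = (\<Union>P\<in>X. \<Union>Q\<in>Y. {P \<inter> Q})" for X Y :: "'d rel set"
    by (auto simp: loi_join_def)
  show ?thesis unfolding * by (simp add: Int_assoc)
qed

lemma tc_joins_tc:
  assumes A: "A \<subseteq> LoI D" and B: "B \<subseteq> LoI D"
  shows "tc D (joins (tc D A) B) = tc D (joins A B)"
proof
  show "tc D (joins A B) \<subseteq> tc D (joins (tc D A) B)"
    by (rule tc_mono) (use tc_extensive[OF A] in blast)
  have "joins (tc D A) B \<subseteq> tc D (joins A B)"
  proof clarify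
    fix P Q assume P: "P \<in> tc D A" and Q: "Q \<in> B"
    then obtain P' where P': "P' \<in> mix D A" "P' \<subseteq> P" by (auto simp: tc_def loi_le_def)
    have cells: "\<exists>R \<in> joins A B. (P' \<inter> Q) `` {d} = R `` {d}" if d: "d \<in> D" for d
    proof -
      obtain R where "R \<in> A" "P' `` {d} = R `` {d}" using P' d unfolding mix_iff[OF A] by blast
      then have "(P' \<inter> Q) `` {d} = loi_join R Q `` {d}" by (auto simp: loi_join_def)
      then show ?thesis using \<open>R \<in> A\<close> Q by blast
    qed
    have PQ: "P' \<inter> Q \<in> LoI D" "loi_join P Q \<in> LoI D"
      using loi_join_LoI[of P' D Q] loi_join_LoI[of P D Q] P P' Q B
      by (auto simp: mix_def tc_def loi_join_def)
    have "P' \<inter> Q \<in> mix D (joins A B)"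
      by (rule iffD2[OF mix_iff[OF joins_LoI[OF A B]] conjI[OF PQ(1) ballI[OF cells]]])
    moreover have "P' \<inter> Q \<subseteq> loi_join P Q" using P' by (auto simp: loi_join_def)
    ultimately show "loi_join P Q \<in> tc D (joins A B)"
      using PQ(2) unfolding tc_def loi_le_def by blast
  qed
  from tc_mono[OF this, of D] show "tc D (joins (tc D A) B) \<subseteq> tc D (joins A B)"
    by (simp only: tc_idem[OF joins_LoI[OF A B]])
qed

lemma comm_monoid_QoI: "comm_monoid (QoI_monoid D)"
proof (rule comm_monoidI; simp add: QoI_monoid_def)
  fix A assume A: "A \<in> QoI D"
  have [simp]: "loi_join (D \<times> D) P = P" if "P \<in> A" for P
    using that A by (auto simp: loi_join_def QoI_def LoI_def equiv_def)
  have "{loi_join (D \<times> D) Q | Q. Q \<in> A} = A" by force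
  then show "tc D {loi_join (D \<times> D) Q | Q. Q \<in> A} = A" using A by (simp add: QoI_def)
next
  fix A B assume "A \<in> QoI D" "B \<in> QoI D"
  then have AB: "A \<subseteq> LoI D" "B \<subseteq> LoI D" by (auto simp: QoI_def)
  show "tc D (joins A B) \<in> QoI D" using tc_LoI tc_idem[OF joins_LoI[OF AB]] by (simp add: QoI_def)
  show "tc D (joins A B) = tc D (joins B A)" by (subst joins_commute, rule refl)
next
  have "D \<times> D \<in> LoI D" by (auto simp: LoI_def equiv_def refl_on_def sym_def trans_def)
  moreover have "P = D \<times> D" if mem: "P \<in> tc D {D \<times> D}" for P
  proof -
    obtain Q where P: "P \<in> LoI D" "Q \<in> mix D {D \<times> D}" "Q \<subseteq> P"
      using mem unfolding tc_def loi_le_def by blast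
    then have "\<forall>d \<in> D. Q `` {d} = (D \<times> D) `` {d}"
      using \<open>D \<times> D \<in> LoI D\<close> by (simp add: mix_iff)
    then have "D \<times> D \<subseteq> Q" by blast
    then show ?thesis using P by (auto simp: LoI_def equiv_def)
  qed
  ultimately show "{D \<times> D} \<in> QoI D" using tc_extensive[of "{D \<times> D}" D] by (auto simp: QoI_def)
next
  fix A B C assume "A \<in> QoI D" "B \<in> QoI D" "C \<in> QoI D"
  then have L: "A \<subseteq> LoI D" "B \<subseteq> LoI D" "C \<subseteq> LoI D" by (auto simp: QoI_def)
  have "tc D (joins (tc D (joins A B)) C) = tc D (joins (joins A B) C)"
    by (rule tc_joins_tc[OF joins_LoI[OF L(1,2)] L(3)])
  also have "\<dots> = tc D (joins (joins B C) A)" by (subst joins_assoc, subst joins_commute, rule refl)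
  also have "\<dots> = tc D (joins (tc D (joins B C)) A)"
    by (rule tc_joins_tc[OF joins_LoI[OF L(2,3)] L(1), symmetric])
  also have "\<dots> = tc D (joins A (tc D (joins B C)))" by (subst joins_commute, rule refl)
  finally show "tc D (joins (tc D (joins A B)) C) = tc D (joins A (tc D (joins B C)))" .
qed


section \<open>Stores and the two-assignment program\<close>

type_synonym ('var, 'val) store = "'var \<Rightarrow> 'val"

definition assign :: "'var \<Rightarrow> 'var \<Rightarrow> ('var, 'val) store \<Rightarrow> ('var, 'val) store"
  where "assign x y s = s(x := s y)"

definition C3 :: "'var \<Rightarrow> 'var \<Rightarrow> 'var \<Rightarrow> ('var, 'val) store \<Rightarrow> ('var, 'val) store"
  where "C3 u w v\<^sub>0 = assign w v\<^sub>0 \<circ> assign u v\<^sub>0"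

definition encodes_quotients :: "'d set \<Rightarrow> 'val itself \<Rightarrow> bool"
  where "encodes_quotients D (_ :: 'val itself) \<longleftrightarrow>
    (\<forall>P \<in> LoI D. \<exists>enc :: 'd set \<Rightarrow> 'val. inj_on enc (D // P))"


section \<open>Mediators and soundness\<close>

definition bounded_by :: "('d \<rightharpoonup> 'b) \<Rightarrow> 'd rel set \<Rightarrow> bool"
  where "bounded_by h \<PP> \<longleftrightarrow>
    (\<exists>P \<in> \<PP>. \<forall>d d'. (d, d') \<in> P \<and> d \<in> dom h \<and> d' \<in> dom h \<longrightarrow> h d = h d')"

definition mediator_family :: "'d set \<Rightarrow> ('var \<Rightarrow> 'd \<rightharpoonup> 'val) \<Rightarrow> bool"
  where "mediator_family D g \<longleftrightarrow> (\<exists>E \<subseteq> D. \<forall>v. dom (g v) = E)"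

definition tuple :: "('var \<Rightarrow> 'd \<rightharpoonup> 'val) \<Rightarrow> 'd \<rightharpoonup> ('var, 'val) store"
  where "tuple g d = (if \<forall>v. d \<in> dom (g v) then Some (\<lambda>v. the (g v d)) else None)"

definition legal :: "('var \<Rightarrow> 'd rel set) \<Rightarrow> ('var \<Rightarrow> 'd \<rightharpoonup> 'val) \<Rightarrow> bool"
  where "legal \<sigma> g \<longleftrightarrow> (\<forall>v. bounded_by (g v) (\<sigma> v))"

text \<open>
  \<open>restrict s W\<close> is constantly \<^const>\<open>undefined\<close> outside \<open>W\<close>, so two such restrictions are equal
  iff the stores agree on \<open>W\<close>.
\<close>

definition sound ::
  "'d set \<Rightarrow> ('var \<Rightarrow> 'd rel set) \<Rightarrow> (('var, 'val) store \<Rightarrow> ('var, 'val) store)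
    \<Rightarrow> ('var \<Rightarrow> 'd rel set) \<Rightarrow> bool"
  where "sound D \<sigma> c \<Gamma>' \<longleftrightarrow>
    (\<forall>g W'. mediator_family D g \<and> legal \<sigma> g \<longrightarrow>
      bounded_by (\<lambda>d. map_option (\<lambda>s. restrict (c s) W') (tuple g d))
        (\<Otimes>\<^bsub>QoI_monoid D\<^esub>x\<in>W'. \<Gamma>' x))"

end

theory Submission
  imports Defs
begin

text \<open>
  A single singleton observation already forces \<open>\<sigma> v\<^sub>0 \<subseteq> \<Gamma>' u\<close>: for \<open>P \<in> \<sigma> v\<^sub>0\<close>, the mediator family
  that encodes the \<open>P\<close>-cell of \<open>d\<close> in \<open>v\<^sub>0\<close> and is constant elsewhere is legal, and after the program
  \<open>u\<close> holds the code of the cell, so some \<open>R \<in> \<Gamma>' u\<close> refines \<open>P\<close>, whence \<open>P \<in> \<Gamma>' u\<close> by downward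
  closure.  The same holds for \<open>w\<close>, and the tensor is monotone.
\<close>

text \<open>Every member of \<open>\<PP>\<close> lies in \<open>mix D \<PP>\<close>, since all its
  cells come from itself; the closure \<open>tc\<close> then adds whatever is below it.\<close>

lemma QoI_down_closed:
  assumes "\<PP> \<in> QoI D" "R \<in> \<PP>" "P \<in> LoI D" "loi_le P R"
  shows "P \<in> \<PP>"
proof -
  have "R \<in> mix D \<PP>" using assms(1,2) by (auto simp: QoI_def mix_def)
  then have "P \<in> tc D \<PP>" using assms(3,4) by (auto simp: tc_def)
  then show ?thesis using assms(1) by (simp add: QoI_def)
qed

lemma QoI_tensor_mono:
  assumes "A \<subseteq> A'" "B \<subseteq> B'"
  shows "A \<otimes>\<^bsub>QoI_monoid D\<^esub> B \<subseteq> A' \<otimes>\<^bsub>QoI_monoid D\<^esub> B'"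
  unfolding QoI_monoid_def monoid.simps by (rule tc_mono) (use assms in blast)

lemma finprod_QoI_singleton:
  assumes "f x \<in> QoI D"
  shows "(\<Otimes>\<^bsub>QoI_monoid D\<^esub>y\<in>{x}. f y) = f x"
proof -
  interpret comm_monoid "QoI_monoid D" by (rule comm_monoid_QoI)
  have "f x \<in> carrier (QoI_monoid D)" using assms by (simp add: QoI_monoid_def)
  then show ?thesis by simp
qed

text \<open>Abstracting the program to any \<open>c\<close> whose final \<open>x\<close> is the
  initial \<open>y\<close> lets one argument serve both \<open>u\<close> and
  \<open>w\<close>.\<close>

lemma sound_copy_bound:
  fixes \<sigma> \<Gamma>' :: "'var \<Rightarrow> 'd rel set"
    and c :: "('var, 'val) store \<Rightarrow> ('var, 'val) store"
  assumes enc: "encodes_quotients D TYPE('val)"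
    and \<sigma>: "\<sigma> \<in> UNIV \<rightarrow> QoI1 D"
    and \<Gamma>': "\<Gamma>' x \<in> QoI D"
    and copy: "\<And>s. c s x = s y"
    and sound: "sound D \<sigma> c \<Gamma>'"
  shows "\<sigma> y \<subseteq> \<Gamma>' x"
proof
  fix P assume P: "P \<in> \<sigma> y"
  have \<sigma>1: "\<sigma> v \<in> QoI D" "D \<times> D \<in> \<sigma> v" for v
    using \<sigma> by (auto simp: QoI1_def QoI_monoid_def Pi_def)
  have PL: "P \<in> LoI D" using P \<sigma>1(1)[of y] by (auto simp: QoI_def)
  then have eP: "equiv D P" by (simp add: LoI_def)
  obtain e :: "'d set \<Rightarrow> 'val" where e: "inj_on e (D // P)"
    using enc PL by (auto simp: encodes_quotients_def)
  \<comment> \<open>All components are total on \<open>D\<close>, so no pair of points escapes the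
    comparison; \<open>undefined\<close> serves only as a fixed value.\<close>
  define g :: "'var \<Rightarrow> 'd \<rightharpoonup> 'val" where
    "g v d = (if d \<in> D then Some (if v = y then e (P `` {d}) else undefined) else None)" for v d
  have dom: "dom (g v) = D" for v by (auto simp: g_def split: if_splits)
  have "mediator_family D g" using dom by (auto simp: mediator_family_def)
  moreover have "bounded_by (g v) (\<sigma> v)" for v
  proof (cases "v = y")
    case True
    then show ?thesis unfolding bounded_by_def
      using P equiv_class_eq[OF eP] by (intro bexI[of _ P]) (auto simp: dom g_def)
  next
    \<comment> \<open>A constant component is legal through the total relation, which belongs to
      \<open>\<sigma> v\<close> because \<open>1\<close> is below it.\<close>
    case False
    then show ?thesis unfolding bounded_by_def
      using \<sigma>1(2)[of v] by (intro bexI[of _ "D \<times> D"]) (auto simp: g_def)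
  qed
  ultimately have "mediator_family D g \<and> legal \<sigma> g" by (simp add: legal_def)
  then have "bounded_by (\<lambda>d. map_option (\<lambda>s. restrict (c s) {x}) (tuple g d))
      (\<Otimes>\<^bsub>QoI_monoid D\<^esub>y\<in>{x}. \<Gamma>' y)"
    using sound unfolding sound_def by blast
  then have "bounded_by (\<lambda>d. map_option (\<lambda>s. restrict (c s) {x}) (tuple g d)) (\<Gamma>' x)"
    by (simp only: finprod_QoI_singleton[of \<Gamma>' x, OF \<Gamma>'])
  then obtain R where R: "R \<in> \<Gamma>' x"
    and eq: "\<And>d d'. (d, d') \<in> R \<Longrightarrow> tuple g d \<noteq> None \<Longrightarrow> tuple g d' \<noteq> None \<Longrightarrow>
      map_option (\<lambda>s. restrict (c s) {x}) (tuple g d) = map_option (\<lambda>s. restrict (c s) {x}) (tuple g d')"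
    unfolding bounded_by_def domIff option.map_disc_iff by blast
  have tuple: "tuple g d = Some (\<lambda>v. the (g v d))" if "d \<in> D" for d
    using that by (simp add: tuple_def dom)
  have "R \<subseteq> P"
  proof clarify
    fix d d' assume dd: "(d, d') \<in> R"
    have "R \<subseteq> D \<times> D" using R \<Gamma>' by (auto simp: QoI_def LoI_def equiv_def)
    then have D: "d \<in> D" "d' \<in> D" using dd by auto
    have "restrict (c (\<lambda>v. the (g v d))) {x} = restrict (c (\<lambda>v. the (g v d'))) {x}"
      using eq[OF dd] by (simp add: tuple D)
    \<comment> \<open>Reading the restricted store at \<open>x\<close> recovers the initial value of
      \<open>y\<close>, the code of the cell.\<close>
    from fun_cong[OF this, of x] have "e (P `` {d}) = e (P `` {d'})"
      using D by (simp add: copy g_def)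
    then have "P `` {d} = P `` {d'}" using inj_onD[OF e] D by (simp add: quotientI)
    then show "(d, d') \<in> P" using eq_equiv_class[OF _ eP] D by blast
  qed
  then show "P \<in> \<Gamma>' x" using QoI_down_closed[OF \<Gamma>' R PL] by (simp add: loi_le_def)
qed

theorem proposition7:
  fixes D :: "'d set"
    and \<sigma> \<Gamma>' :: "'var::finite \<Rightarrow> 'd rel set"
    and u w v\<^sub>0 :: 'var
  assumes "finite D"
    and "encodes_quotients D TYPE('val)"
    and "\<sigma> \<in> UNIV \<rightarrow> QoI1 D"
    and "\<Gamma>' \<in> UNIV \<rightarrow> QoI D"
    and "distinct [u, w, v\<^sub>0]"
    and "sound D \<sigma> (C3 u w v\<^sub>0 :: ('var, 'val) store \<Rightarrow> ('var, 'val) store) \<Gamma>'"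
  shows "\<sigma> v\<^sub>0 \<otimes>\<^bsub>QoI_monoid D\<^esub> \<sigma> v\<^sub>0 \<subseteq> \<Gamma>' u \<otimes>\<^bsub>QoI_monoid D\<^esub> \<Gamma>' w"
proof (rule QoI_tensor_mono)
  show "\<sigma> v\<^sub>0 \<subseteq> \<Gamma>' u"
    by (rule sound_copy_bound[OF assms(2,3) _ _ assms(6)])
      (use assms(4,5) in \<open>auto simp: C3_def assign_def\<close>)
  \<comment> \<open>The first assignment leaves the value of \<open>v\<^sub>0\<close> intact, so the
    second copies its initial value too.\<close>
  show "\<sigma> v\<^sub>0 \<subseteq> \<Gamma>' w"
    by (rule sound_copy_bound[OF assms(2,3) _ _ assms(6)])
      (use assms(4,5) in \<open>auto simp: C3_def assign_def\<close>)
qed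

end
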